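(* Let $A\in\mathbb{R}^{m\times n}$, $(\bar b,\bar\lambda)\in\mathbb{R}^m\times\mathbb{R}_{++}$, and let $\bar x$ be a solution of $\min_{x\in\mathbb{R}^n}\frac12\|Ax-\bar b\|^2+\bar\lambda\|x\|_1$. Let $I:=\mathrm{supp}(\bar x)$ and $J:=\{i\in\{1,\dots,n\}:|A_i^T(\bar b-A\bar x)|=\bar\lambda\}$. Consider the solution map (with $\bar b$ fixed) $$S:\lambda\mapsto\operatorname*{argmin}_{x\in\mathbb{R}^n}\left\{\tfrac12\|Ax-\bar b\|^2+\lambda\|x\|_1\right\}.$$ (a) If $A_J$ has full column rank, then $S$ is locally Lipschitz at $\bar\lambda$ with constant $L\le\sqrt{|J|}\,\sigma_{\min}(A_J)^{-2}$. (b) If $A_I$ has full column rank $|I|$ and $\|A_{I^C}^T(\bar b-A_I\bar x_I)\|_\infty<\bar\lambda$, then $S$ is locally Lipschitz at $\bar\lambda$ with constant $L\le\sqrt{|I|}\,\sigma_{\min}(A_I)^{-2}$.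
   Context: $\|\cdot\|$ is the Euclidean norm, $\mathbb{R}_{++}=(0,\infty)$, $\mathrm{supp}(x)=\{i:x_i\neq0\}$, $I^C=\{1,\dots,n\}\setminus I$. $A_i$ is the $i$th column of $A$, $A_I$ the submatrix of columns indexed by $I$, $x_I$ the subvector indexed by $I$. $\sigma_{\min}(B)$ is the smallest positive singular value of $B$. "Locally Lipschitz at $\bar\lambda$ with constant $L$" means that $S$ is single-valued and Lipschitz on a neighborhood of $\bar\lambda$, where $L=\limsup_{\lambda,\lambda'\to\bar\lambda,\,\lambda\neq\lambda'}\|S(\lambda)-S(\lambda')\|/|\lambda-\lambda'|$ is the local Lipschitz modulus. For an empty index set the bound is read as $0$. *)

theory Defs
  imports "HOL-Analysis.Analysis"
begin

section \<open>The LASSO problem\<close>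

definition lasso_objective ::
    "real ^ 'n ^ 'm \<Rightarrow> real ^ 'm \<Rightarrow> real \<Rightarrow> real ^ 'n \<Rightarrow> real" where
  "lasso_objective A b lam x = 1 / 2 * (norm (A *v x - b))\<^sup>2 + lam * (\<Sum>i\<in>UNIV. \<bar>x $ i\<bar>)"

definition lasso_argmin ::
    "real ^ 'n ^ 'm \<Rightarrow> real ^ 'm \<Rightarrow> real \<Rightarrow> (real ^ 'n) set" where
  "lasso_argmin A b lam = {x. is_arg_min (lasso_objective A b lam) (\<lambda>_. True) x}"

definition vec_supp :: "real ^ 'n \<Rightarrow> 'n set" where
  "vec_supp x = {i. x $ i \<noteq> 0}"


section \<open>Column submatrices\<close>

text \<open>Since the index set \<open>K\<close> is not a type, the submatrix \<open>A_K\<close> of the columns indexed by \<open>K\<close> is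
  encoded by keeping its columns in place and filling up with zero columns. This changes neither
  the rank nor the positive singular values, and \<open>col_submatrix A K *v x\<close> is the product of
  \<open>A_K\<close> with the subvector \<open>x_K\<close>; see the lemmas below. Multiplication by the transpose pads
  the vector \<open>A_K\<^sup>T r\<close> with zeros, so that its norms are unchanged as well (and are 0 if \<open>K\<close> is
  empty).\<close>

definition col_submatrix :: "real ^ 'n ^ 'm \<Rightarrow> 'n set \<Rightarrow> real ^ 'n ^ 'm" where
  "col_submatrix A K = (\<chi> i j. if j \<in> K then A $ i $ j else 0)"

text \<open>The number of columns of \<open>A_K\<close> is \<open>card K\<close>.\<close>

definition full_column_rank_on :: "real ^ 'n ^ 'm \<Rightarrow> 'n set \<Rightarrow> bool" where
  "full_column_rank_on A K \<longleftrightarrow> rank (col_submatrix A K) = card K"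


section \<open>Singular values\<close>

text \<open>The singular values of \<open>B\<close> are the square roots of the eigenvalues of \<open>B\<^sup>T B\<close>.\<close>

definition singular_value :: "real ^ 'n ^ 'm \<Rightarrow> real \<Rightarrow> bool" where
  "singular_value B s \<longleftrightarrow>
     s \<ge> 0 \<and> (\<exists>v. v \<noteq> 0 \<and> (transpose B ** B) *v v = s\<^sup>2 *\<^sub>R v)"

text \<open>The smallest positive singular value; unspecified if \<open>B = 0\<close>.\<close>

definition sigma_min :: "real ^ 'n ^ 'm \<Rightarrow> real" where
  "sigma_min B = (LEAST s. s > 0 \<and> singular_value B s)"


section \<open>Local Lipschitz continuity of set-valued maps\<close>

text \<open>The limit superior runs over pairs \<open>(t, t')\<close> tending to \<open>(l, l)\<close> with \<open>t \<noteq> t'\<close>.\<close>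

definition lipschitz_modulus :: "(real \<Rightarrow> 'a::real_normed_vector) \<Rightarrow> real \<Rightarrow> ereal" where
  "lipschitz_modulus f l =
     Limsup (at (l, l) within {(t, t'). t \<noteq> t'}) (\<lambda>(t, t'). ereal (norm (f t - f t') / \<bar>t - t'\<bar>))"

definition locally_lipschitz_with ::
    "(real \<Rightarrow> 'a::real_normed_vector set) \<Rightarrow> real \<Rightarrow> real \<Rightarrow> bool" where
  "locally_lipschitz_with S l L \<longleftrightarrow>
     (\<exists>U f C. open U \<and> l \<in> U \<and> (\<forall>t\<in>U. S t = {f t}) \<and> C-lipschitz_on U f \<and>
        ereal L = lipschitz_modulus f l)"


section \<open>Adequacy of the encoding of submatrices\<close>

lemma col_submatrix_mult_vec:
  "col_submatrix A K *v x = (\<Sum>i\<in>K. x $ i *\<^sub>R column i A)"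
proof -
  have "(if j \<in> K then a else 0) * c = (if j \<in> K then c * a else 0)" for j and a c :: real
    by simp
  then show ?thesis
    by (simp add: vec_eq_iff col_submatrix_def matrix_vector_mult_def column_def sum.If_cases)
qed

lemma transpose_col_submatrix_mult_vec:
  "(transpose (col_submatrix A K) *v r) $ i = (if i \<in> K then column i A \<bullet> r else 0)"
  by (simp add: col_submatrix_def transpose_def matrix_vector_mult_def column_def inner_vec_def)

text \<open>In the following, \<open>f\<close> enumerates \<open>K\<close> and \<open>\<chi> i k. A $ i $ f k\<close> is \<open>A_K\<close> as a genuine matrix.\<close>

lemma col_submatrix_enum_mult_vec:
  fixes f :: "'j::finite \<Rightarrow> 'n::finite" and A :: "real ^ 'n ^ 'm"
  assumes "inj f" "range f = K"
  shows "col_submatrix A K *v x = (\<chi> i k. A $ i $ f k) *v (\<chi> k. x $ f k)"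
proof -
  have "(\<Sum>i\<in>K. x $ i *\<^sub>R column i A) = (\<Sum>k\<in>UNIV. x $ f k *\<^sub>R column (f k) A)"
    using sum.reindex[OF assms(1), of "\<lambda>i. x $ i *\<^sub>R column i A"] assms(2) by simp
  then show ?thesis
    unfolding col_submatrix_mult_vec
    by (simp add: vec_eq_iff matrix_vector_mult_def column_def mult.commute)
qed

lemma rank_col_submatrix:
  fixes f :: "'j::finite \<Rightarrow> 'n::finite" and A :: "real ^ 'n ^ 'm"
  assumes "inj f" "range f = K"
  shows "rank (col_submatrix A K) = rank (\<chi> i k. A $ i $ f k)"
proof -
  have "range ((*v) (col_submatrix A K)) = range ((*v) (\<chi> i k. A $ i $ f k))" (is "?L = ?R")
  proof
    show "?L \<subseteq> ?R"
      using col_submatrix_enum_mult_vec[OF assms, of A] by auto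
    show "?R \<subseteq> ?L"
    proof clarify
      fix y :: "real ^ 'j"
      have "(\<chi> k. (\<chi> i. y $ inv f i) $ f k) = y"
        using assms(1) by (simp add: vec_eq_iff)
      then show "(\<chi> i k. A $ i $ f k) *v y \<in> ?L"
        using col_submatrix_enum_mult_vec[OF assms, of A "\<chi> i. y $ inv f i"] by (metis rangeI)
    qed
  qed
  then show ?thesis
    by (simp add: rank_dim_range)
qed

lemma singular_value_col_submatrix:
  fixes f :: "'j::finite \<Rightarrow> 'n::finite" and A :: "real ^ 'n ^ 'm"
  assumes f: "inj f" "range f = K" and "s > 0"
  shows "singular_value (col_submatrix A K) s \<longleftrightarrow> singular_value (\<chi> i k. A $ i $ f k) s"
proof -
  let ?B = "\<chi> i k. A $ i $ f k :: real ^ 'j ^ 'm" and ?C = "col_submatrix A K"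
  define p where "p v = (\<chi> k. v $ f k)" for v :: "real ^ 'n"
  have C: "?C *v v = ?B *v p v" for v
    using col_submatrix_enum_mult_vec[OF f] by (simp add: p_def)
  have off: "(transpose ?C *v r) $ i = 0" if "i \<notin> K" for r i
    using that by (simp add: transpose_col_submatrix_mult_vec del: transpose_matrix_vector)
  have on: "(transpose ?C *v r) $ f k = (transpose ?B *v r) $ k" for r k
    using f by (auto simp: col_submatrix_def transpose_def matrix_vector_mult_def
        simp del: transpose_matrix_vector)
  have eq: "(transpose ?C ** ?C) *v v = s\<^sup>2 *\<^sub>R v \<longleftrightarrow>
      (transpose ?B ** ?B) *v p v = s\<^sup>2 *\<^sub>R p v \<and> (\<forall>i. i \<notin> K \<longrightarrow> v $ i = 0)" for v
  proof -
    have "(transpose ?C ** ?C) *v v = s\<^sup>2 *\<^sub>R v \<longleftrightarrow>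
      (\<forall>i\<in>K. (transpose ?C *v (?B *v p v)) $ i = s\<^sup>2 * v $ i) \<and>
      (\<forall>i. i \<notin> K \<longrightarrow> (transpose ?C *v (?B *v p v)) $ i = s\<^sup>2 * v $ i)"
      by (auto simp: vec_eq_iff C simp del: transpose_matrix_vector simp flip: matrix_vector_mul_assoc)
    also have "(\<forall>i\<in>K. (transpose ?C *v (?B *v p v)) $ i = s\<^sup>2 * v $ i) \<longleftrightarrow>
        (transpose ?B ** ?B) *v p v = s\<^sup>2 *\<^sub>R p v"
      using f(2) on by (auto simp: vec_eq_iff p_def simp del: transpose_matrix_vector simp flip: matrix_vector_mul_assoc)
    also have "(\<forall>i. i \<notin> K \<longrightarrow> (transpose ?C *v (?B *v p v)) $ i = s\<^sup>2 * v $ i) \<longleftrightarrow>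
        (\<forall>i. i \<notin> K \<longrightarrow> v $ i = 0)"
      using \<open>s > 0\<close> off by auto
    finally show ?thesis .
  qed
  have nz: "p v \<noteq> 0" if "v \<noteq> 0" "\<forall>i. i \<notin> K \<longrightarrow> v $ i = 0" for v
    using that f(2) by (force simp: vec_eq_iff p_def)
  have ext: "\<exists>v. p v = w \<and> (\<forall>i. i \<notin> K \<longrightarrow> v $ i = 0)" for w
    using f by (intro exI[of _ "\<chi> i. if i \<in> K then w $ inv f i else 0"])
      (auto simp: p_def vec_eq_iff)
  have p0: "p 0 = 0"
    by (simp add: p_def vec_eq_iff)
  have "(\<exists>v. v \<noteq> 0 \<and> (transpose ?C ** ?C) *v v = s\<^sup>2 *\<^sub>R v) \<longleftrightarrow>
      (\<exists>w. w \<noteq> 0 \<and> (transpose ?B ** ?B) *v w = s\<^sup>2 *\<^sub>R w)"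
    (is "?l \<longleftrightarrow> ?r")
  proof
    assume ?l
    then show ?r
      unfolding eq using nz by blast
  next
    assume ?r
    then obtain w where w: "w \<noteq> 0" "(transpose ?B ** ?B) *v w = s\<^sup>2 *\<^sub>R w"
      by blast
    obtain v where v: "p v = w" "\<forall>i. i \<notin> K \<longrightarrow> v $ i = 0"
      using ext by blast
    have "v \<noteq> 0"
      using w(1) v(1) p0 by blast
    moreover have "(transpose ?C ** ?C) *v v = s\<^sup>2 *\<^sub>R v"
      unfolding eq v(1) using w(2) v(2) by blast
    ultimately show ?l
      by blast
  qed
  then show ?thesis
    by (simp add: singular_value_def)
qed

lemma sigma_min_col_submatrix:
  fixes f :: "'j::finite \<Rightarrow> 'n::finite" and A :: "real ^ 'n ^ 'm"
  assumes "inj f" "range f = K"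
  shows "sigma_min (col_submatrix A K) = sigma_min (\<chi> i k. A $ i $ f k)"
proof -
  have "(\<lambda>s. s > 0 \<and> singular_value (col_submatrix A K) s) =
      (\<lambda>s. s > 0 \<and> singular_value (\<chi> i k. A $ i $ f k) s)"
    using singular_value_col_submatrix[OF assms] by blast
  then show ?thesis
    by (simp add: sigma_min_def)
qed

end

theory Submission
  imports Defs
begin

text \<open>
  Write \<open>g(x) = A\<^sup>T(b - A x)\<close>. Convexity of the objective shows that every minimizer \<open>x\<close> for the
  parameter \<open>t\<close> satisfies \<open>g(x) \<bullet> (y - x) \<le> t (\<parallel>y\<parallel>\<^sub>1 - \<parallel>x\<parallel>\<^sub>1)\<close> for all \<open>y\<close>
  (\<open>lasso_variational_inequality\<close>). Adding this inequality for two minimizers \<open>x\<close>, \<open>x'\<close> at the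
  parameters \<open>t\<close>, \<open>t'\<close> gives the key estimate
  \<open>\<parallel>A(x - x')\<parallel>\<^sup>2 \<le> (t' - t) (\<parallel>x\<parallel>\<^sub>1 - \<parallel>x'\<parallel>\<^sub>1)\<close> (\<open>lasso_two_minimizers\<close>).

  As the minimizers are bounded for \<open>t\<close> away from 0, the estimate shows that \<open>g(x)\<close> is close to
  \<open>g(xbar)\<close> when \<open>t\<close> is close to \<open>lam\<close>. Hence the coordinates of \<open>g(x)\<close> outside \<open>J\<close> stay strictly
  below \<open>t\<close> in absolute value, and \<open>x\<close> vanishes outside \<open>J\<close> (\<open>eventually_lasso_supp_subset\<close>).
  For such minimizers \<open>\<parallel>x - x'\<parallel>\<^sub>1 \<le> sqrt |J| \<parallel>x - x'\<parallel>\<close>, while full column rank gives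
  \<open>\<parallel>A(x - x')\<parallel>\<^sup>2 \<ge> \<sigma>\<^sup>2 \<parallel>x - x'\<parallel>\<^sup>2\<close> for the smallest positive singular value \<open>\<sigma>\<close> of
  \<open>A\<^sub>J\<close> (\<open>sigma_min_bound\<close>). So
  \<open>\<parallel>x - x'\<parallel> \<le> sqrt |J| \<sigma>\<^sup>-\<^sup>2 |t - t'|\<close>, which contains both uniqueness (take \<open>t = t'\<close>) and the
  Lipschitz bound; minimizers exist for \<open>t > 0\<close> since the objective is continuous and coercive.

  Part (b) is a special case of part (a): on the support, \<open>|g(xbar)| = lam\<close> by optimality, and the
  strict inequality off the support then says that \<open>I = J\<close>.
\<close>

section \<open>Optimality conditions\<close>

text \<open>The norm \<open>\<parallel>x\<parallel>\<^sub>1\<close>.\<close>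

definition l1_norm :: "real ^ 'n \<Rightarrow> real" where
  "l1_norm x = (\<Sum>i\<in>UNIV. \<bar>x $ i\<bar>)"

lemma l1_norm_nonneg: "0 \<le> l1_norm x"
  by (simp add: l1_norm_def sum_nonneg)

lemma norm_le_l1_norm: "norm x \<le> l1_norm x"
  by (simp add: l1_norm_def norm_le_l1_cart)

lemma l1_norm_diff_le: "\<bar>l1_norm x - l1_norm y\<bar> \<le> l1_norm (x - y)"
proof -
  have "\<bar>l1_norm x - l1_norm y\<bar> = \<bar>\<Sum>i\<in>UNIV. \<bar>x $ i\<bar> - \<bar>y $ i\<bar>\<bar>"
    by (simp add: l1_norm_def sum_subtractf)
  also have "\<dots> \<le> (\<Sum>i\<in>UNIV. \<bar>\<bar>x $ i\<bar> - \<bar>y $ i\<bar>\<bar>)"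
    by (rule sum_abs)
  also have "\<dots> \<le> l1_norm (x - y)"
    unfolding l1_norm_def by (intro sum_mono) auto
  finally show ?thesis .
qed

lemma l1_norm_axis: "l1_norm (axis i c) = \<bar>c\<bar>"
proof -
  have "l1_norm (axis i c) = (\<Sum>j\<in>UNIV. if j = i then \<bar>c\<bar> else 0)"
    unfolding l1_norm_def by (intro sum.cong) (auto simp: axis_def)
  then show ?thesis
    by simp
qed

lemma l1_norm_le_sqrt_card_norm:
  assumes "vec_supp v \<subseteq> K"
  shows "l1_norm v \<le> sqrt (real (card K)) * norm v"
proof -
  have "l1_norm v = (\<Sum>i\<in>K. \<bar>1\<bar> * \<bar>v $ i\<bar>)"
    unfolding l1_norm_def using assms by (intro sum.mono_neutral_cong_right) (auto simp: vec_supp_def)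
  also have "\<dots> \<le> L2_set (\<lambda>_. 1) K * L2_set (\<lambda>i. v $ i) K"
    by (rule L2_set_mult_ineq)
  also have "L2_set (\<lambda>_. 1 :: real) K = sqrt (real (card K))"
    by (simp add: L2_set_def)
  also have "L2_set (\<lambda>i. v $ i) K \<le> norm v"
    unfolding norm_vec_def L2_set_def by (auto intro!: sum_mono2)
  finally show ?thesis
    by (simp add: mult_left_mono)
qed

lemma lasso_objective_l1_norm:
  "lasso_objective A b t x = 1 / 2 * (norm (A *v x - b))\<^sup>2 + t * l1_norm x"
  by (simp add: lasso_objective_def l1_norm_def)

lemma in_lasso_argmin_iff:
  "x \<in> lasso_argmin A b t \<longleftrightarrow> (\<forall>y. lasso_objective A b t x \<le> lasso_objective A b t y)"
  by (simp add: lasso_argmin_def is_arg_min_linorder)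

lemma power2_norm_add_scaleR:
  fixes u v :: "'a :: real_inner"
  shows "(norm (u + s *\<^sub>R v))\<^sup>2 = (norm u)\<^sup>2 + 2 * s * (u \<bullet> v) + s\<^sup>2 * (norm v)\<^sup>2"
  unfolding power2_norm_eq_inner by (simp add: inner_add inner_commute power2_eq_square)

text \<open>First-order optimality: minus the gradient of the quadratic term is a subgradient of
  \<open>t \<parallel>\<cdot>\<parallel>\<^sub>1\<close> at the minimizer.\<close>

lemma lasso_variational_inequality:
  fixes A :: "real ^ 'n ^ 'm"
  assumes x: "x \<in> lasso_argmin A b t" and t: "0 \<le> t"
  shows "(b - A *v x) \<bullet> (A *v (y - x)) \<le> t * (l1_norm y - l1_norm x)"
proof -
  define d where "d = A *v (y - x)"
  define p where "p = (b - A *v x) \<bullet> d - t * (l1_norm y - l1_norm x)"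
  \<comment> \<open>Compare the objective at \<open>x\<close> and at \<open>x + s (y - x)\<close>, divide by \<open>s\<close> and let \<open>s\<close> tend to 0.\<close>
  have step: "p \<le> s / 2 * (norm d)\<^sup>2" if s: "0 < s" "s \<le> 1" for s
  proof -
    define z where "z = x + s *\<^sub>R (y - x)"
    have "l1_norm z \<le> (\<Sum>i\<in>UNIV. (1 - s) * \<bar>x $ i\<bar> + s * \<bar>y $ i\<bar>)"
      unfolding l1_norm_def
    proof (rule sum_mono)
      fix i
      have "z $ i = (1 - s) * x $ i + s * y $ i"
        by (simp add: z_def algebra_simps)
      then show "\<bar>z $ i\<bar> \<le> (1 - s) * \<bar>x $ i\<bar> + s * \<bar>y $ i\<bar>"
        using s abs_triangle_ineq[of "(1 - s) * x $ i" "s * y $ i"] by (simp add: abs_mult)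
    qed
    also have "\<dots> = l1_norm x + s * (l1_norm y - l1_norm x)"
      by (simp add: l1_norm_def sum.distrib sum_distrib_left sum_subtractf algebra_simps)
    finally have l1: "t * l1_norm z \<le> t * (l1_norm x + s * (l1_norm y - l1_norm x))"
      using t by (rule mult_left_mono)
    have residual: "A *v z - b = (A *v x - b) + s *\<^sub>R d"
      by (simp add: z_def d_def matrix_vector_right_distrib matrix_vector_mult_scaleR)
    have "(norm (A *v z - b))\<^sup>2
        = (norm (A *v x - b))\<^sup>2 + 2 * s * ((A *v x - b) \<bullet> d) + s\<^sup>2 * (norm d)\<^sup>2"
      unfolding residual by (rule power2_norm_add_scaleR)
    moreover have "(A *v x - b) \<bullet> d = - ((b - A *v x) \<bullet> d)"
      by (simp add: inner_diff_left)
    moreover have "lasso_objective A b t x \<le> lasso_objective A b t z"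
      using x by (simp add: in_lasso_argmin_iff)
    ultimately have "s * p \<le> s * (s / 2 * (norm d)\<^sup>2)"
      using l1 by (simp add: lasso_objective_l1_norm p_def algebra_simps power2_eq_square)
    then show ?thesis
      using s by simp
  qed
  have "p \<le> 0"
  proof (rule tendsto_lowerbound)
    show "((\<lambda>s. s / 2 * (norm d)\<^sup>2) \<longlongrightarrow> 0) (at_right (0::real))"
      by (auto intro!: tendsto_eq_intros)
    have "\<forall>\<^sub>F s in at_right (0::real). s \<in> {0<..<1}"
      by (rule eventually_at_right_real) simp
    then show "\<forall>\<^sub>F s in at_right (0::real). p \<le> s / 2 * (norm d)\<^sup>2"
      by eventually_elim (rule step; simp)
  qed simp
  then show ?thesis
    by (simp add: p_def d_def)
qed

lemma lasso_two_minimizers: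
  assumes "x \<in> lasso_argmin A b t" "x' \<in> lasso_argmin A b t'" "0 \<le> t" "0 \<le> t'"
  shows "(norm (A *v (x - x')))\<^sup>2 \<le> (t' - t) * (l1_norm x - l1_norm x')"
proof -
  have "(b - A *v x) \<bullet> (A *v (x' - x)) \<le> t * (l1_norm x' - l1_norm x)"
    "(b - A *v x') \<bullet> (A *v (x - x')) \<le> t' * (l1_norm x - l1_norm x')"
    using assms by (blast intro: lasso_variational_inequality)+
  moreover have "(norm (A *v (x - x')))\<^sup>2
      = (b - A *v x) \<bullet> (A *v (x' - x)) + (b - A *v x') \<bullet> (A *v (x - x'))"
    by (simp add: power2_norm_eq_inner matrix_vector_mult_diff_distrib inner_diff inner_commute)
  ultimately show ?thesis
    by (simp add: algebra_simps)
qed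

lemma lasso_two_minimizers_abs:
  assumes "x \<in> lasso_argmin A b t" "x' \<in> lasso_argmin A b t'" "0 \<le> t" "0 \<le> t'"
  shows "(norm (A *v (x - x')))\<^sup>2 \<le> \<bar>t - t'\<bar> * \<bar>l1_norm x - l1_norm x'\<bar>"
proof -
  have "(t' - t) * (l1_norm x - l1_norm x') \<le> \<bar>(t' - t) * (l1_norm x - l1_norm x')\<bar>"
    by (rule abs_ge_self)
  then show ?thesis
    using lasso_two_minimizers[OF assms] by (simp add: abs_mult abs_minus_commute)
qed

lemma inner_mult_axis:
  fixes A :: "real ^ 'n ^ 'm"
  shows "r \<bullet> (A *v axis i c) = c * (column i A \<bullet> r)"
  by (simp add: matrix_vector_mult_basis matrix_vector_mult_def axis_def column_def inner_vec_def
      if_distrib sum_distrib_left mult_ac cong: if_cong)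

lemma lasso_gradient_bound:
  assumes "x \<in> lasso_argmin A b t" "0 \<le> t"
  shows "\<bar>column i A \<bullet> (b - A *v x)\<bar> \<le> t"
proof -
  have "c * (column i A \<bullet> (b - A *v x)) \<le> t" if "\<bar>c\<bar> = 1" for c
  proof -
    have "c * (column i A \<bullet> (b - A *v x)) \<le> t * (l1_norm (x + axis i c) - l1_norm x)"
      using lasso_variational_inequality[OF assms, of "x + axis i c"] by (simp add: inner_mult_axis)
    also have "\<dots> \<le> t * 1"
      using l1_norm_diff_le[of "x + axis i c" x] that assms(2)
      by (intro mult_left_mono) (auto simp: l1_norm_axis)
    finally show ?thesis
      by simp
  qed
  from this[of 1] this[of "- 1"] show ?thesis
    by simp
qed

lemma lasso_gradient_on_supp:
  assumes "x \<in> lasso_argmin A b t" "0 \<le> t" "x $ i \<noteq> 0"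
  shows "\<bar>column i A \<bullet> (b - A *v x)\<bar> = t"
proof -
  \<comment> \<open>The competitor \<open>y\<close> arises from \<open>x\<close> by setting coordinate \<open>i\<close> to 0.\<close>
  define y where "y = x + axis i (- x $ i)"
  have "l1_norm x - l1_norm y = (\<Sum>j\<in>UNIV. if j = i then \<bar>x $ i\<bar> else 0)"
    unfolding l1_norm_def sum_subtractf[symmetric]
    by (intro sum.cong) (auto simp: y_def axis_def)
  then have "l1_norm y - l1_norm x = - \<bar>x $ i\<bar>"
    by simp
  then have "t * \<bar>x $ i\<bar> \<le> x $ i * (column i A \<bullet> (b - A *v x))"
    using lasso_variational_inequality[OF assms(1,2), of y]
    by (simp add: y_def inner_mult_axis)
  also have "\<dots> \<le> \<bar>x $ i\<bar> * \<bar>column i A \<bullet> (b - A *v x)\<bar>"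
    by (metis abs_ge_self abs_mult)
  finally have "t \<le> \<bar>column i A \<bullet> (b - A *v x)\<bar>"
    using assms(3) by (simp add: mult.commute)
  then show ?thesis
    using lasso_gradient_bound[OF assms(1,2), of i] by simp
qed

section \<open>Existence, boundedness and support of minimizers\<close>

lemma lasso_l1_norm_sublevel:
  assumes "0 < t" "lasso_objective A b t x \<le> lasso_objective A b t 0"
  shows "l1_norm x \<le> (norm b)\<^sup>2 / (2 * t)"
proof -
  have "t * l1_norm x \<le> lasso_objective A b t x"
    by (simp add: lasso_objective_l1_norm)
  also have "\<dots> \<le> (norm b)\<^sup>2 / 2"
    using assms(2) by (simp add: lasso_objective_l1_norm l1_norm_def)
  finally show ?thesis
    using assms(1) by (simp add: field_simps)
qed

lemma lasso_argmin_nonempty: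
  fixes A :: "real ^ 'n ^ 'm"
  assumes t: "0 < t"
  shows "lasso_argmin A b t \<noteq> {}"
proof -
  let ?F = "lasso_objective A b t"
  define D where "D = {x. ?F x \<le> ?F 0}"
  have cont: "continuous_on UNIV ?F"
    unfolding lasso_objective_def
    by (intro continuous_intros matrix_vector_mult_linear_continuous_on)
  then have "closed D"
    unfolding D_def by (intro closed_Collect_le continuous_intros)
  moreover have "bounded D"
    unfolding bounded_iff D_def
    using lasso_l1_norm_sublevel[OF t, of A b] norm_le_l1_norm order_trans by blast
  ultimately have "compact D"
    by (simp add: compact_eq_bounded_closed)
  moreover have zero: "0 \<in> D"
    by (simp add: D_def)
  moreover have "continuous_on D ?F"
    using cont continuous_on_subset by blast
  ultimately obtain x where x: "x \<in> D" "\<And>y. y \<in> D \<Longrightarrow> ?F x \<le> ?F y"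
    using continuous_attains_inf[of D ?F] by auto
  have "?F x \<le> ?F y" for y
    using x zero by (cases "y \<in> D") (force simp: D_def)+
  then have "x \<in> lasso_argmin A b t"
    by (simp add: in_lasso_argmin_iff)
  then show ?thesis
    by blast
qed

lemma eventually_lasso_supp_subset:
  fixes A :: "real ^ 'n ^ 'm"
  assumes lam: "0 < lam" and xbar: "xbar \<in> lasso_argmin A b lam"
    and J: "J = {i. \<bar>column i A \<bullet> (b - A *v xbar)\<bar> = lam}"
  shows "\<forall>\<^sub>F t in nhds lam. \<forall>x\<in>lasso_argmin A b t. vec_supp x \<subseteq> J"
proof -
  define M where "M = (norm b)\<^sup>2 / lam"
  define g where "g i = \<bar>column i A \<bullet> (b - A *v xbar)\<bar>" for i
  \<comment> \<open>For \<open>t > lam / 2\<close>, all minimizers at \<open>t\<close> have \<open>\<parallel>\<cdot>\<parallel>\<^sub>1 \<le> M\<close>, and \<open>h i t\<close> bounds coordinate \<open>i\<close>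
    of \<open>A\<^sup>T(b - A x)\<close> in absolute value.\<close>
  define h where "h i t = g i + norm (column i A) * sqrt (\<bar>lam - t\<bar> * M)" for i t
  have ev_h: "\<forall>\<^sub>F t in nhds lam. h i t < t" if "i \<notin> J" for i
  proof -
    have "g i < lam"
      using lasso_gradient_bound[OF xbar, of i] lam that J unfolding g_def by force
    moreover have "isCont (\<lambda>t. t - h i t) lam"
      unfolding h_def by (intro continuous_intros)
    then have "((\<lambda>t. t - h i t) \<longlongrightarrow> lam - h i lam) (nhds lam)"
      by (simp add: continuous_at tendsto_nhds_iff)
    ultimately have "\<forall>\<^sub>F t in nhds lam. 0 < t - h i t"
      by (intro order_tendstoD(1)) (auto simp: h_def)
    then show ?thesis
      by simp
  qed
  have "\<forall>\<^sub>F t in nhds lam. \<forall>i\<in>- J. h i t < t"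
    by (intro eventually_ball_finite) (auto intro: ev_h)
  moreover have "\<forall>\<^sub>F t in nhds lam. lam / 2 < t"
    using lam by (intro order_tendstoD(1)[OF filterlim_ident]) simp
  ultimately show ?thesis
  proof eventually_elim
    case (elim t)
    show ?case
    proof (intro ballI subsetI)
      fix x i
      assume x: "x \<in> lasso_argmin A b t" and "i \<in> vec_supp x"
      then have xi: "x $ i \<noteq> 0"
        by (simp add: vec_supp_def)
      have t: "0 < t"
        using elim lam by simp
      have "l1_norm x \<le> (norm b)\<^sup>2 / (2 * t)" "l1_norm xbar \<le> (norm b)\<^sup>2 / (2 * lam)"
        using lasso_l1_norm_sublevel[OF t, of A b x] lasso_l1_norm_sublevel[OF lam, of A b xbar]
          x xbar unfolding in_lasso_argmin_iff by blast+
      moreover have "(norm b)\<^sup>2 / (2 * t) \<le> M" "(norm b)\<^sup>2 / (2 * lam) \<le> M"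
        unfolding M_def using elim lam by (auto intro!: divide_left_mono)
      ultimately have "\<bar>l1_norm x - l1_norm xbar\<bar> \<le> M"
        using l1_norm_nonneg[of x] l1_norm_nonneg[of xbar] by linarith
      then have "\<bar>lam - t\<bar> * \<bar>l1_norm x - l1_norm xbar\<bar> \<le> \<bar>lam - t\<bar> * M"
        by (intro mult_left_mono) auto
      moreover have "(norm (A *v (x - xbar)))\<^sup>2 \<le> \<bar>lam - t\<bar> * \<bar>l1_norm x - l1_norm xbar\<bar>"
        using lasso_two_minimizers_abs[OF x xbar] t lam by (simp add: abs_minus_commute)
      ultimately have close: "norm (A *v (x - xbar)) \<le> sqrt (\<bar>lam - t\<bar> * M)"
        by (intro real_le_rsqrt) linarith
      have "column i A \<bullet> (b - A *v x)
          = column i A \<bullet> (b - A *v xbar) - column i A \<bullet> (A *v (x - xbar))"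
        by (simp add: matrix_vector_mult_diff_distrib inner_diff_right)
      then have "\<bar>column i A \<bullet> (b - A *v x)\<bar> \<le> g i + \<bar>column i A \<bullet> (A *v (x - xbar))\<bar>"
        by (simp add: g_def)
      also have "\<dots> \<le> g i + norm (column i A) * norm (A *v (x - xbar))"
        by (simp add: Cauchy_Schwarz_ineq2)
      also have "\<dots> \<le> h i t"
        unfolding h_def using close by (simp add: mult_left_mono)
      finally have "t \<le> h i t"
        using lasso_gradient_on_supp[OF x _ xi] t by simp
      then show "i \<in> J"
        using elim by force
    qed
  qed
qed

section \<open>The smallest singular value\<close>

text \<open>Since \<open>A\<^sub>K\<close> is padded with zero columns, the vectors that it acts on are those supported
  in \<open>K\<close>.\<close>

lemma subspace_supp:
  fixes K :: "'n::finite set"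
  shows "subspace {v :: real ^ 'n. vec_supp v \<subseteq> K}"
  unfolding subspace_def vec_supp_def by force

lemma col_submatrix_mult_supp:
  assumes "vec_supp v \<subseteq> K"
  shows "col_submatrix A K *v v = A *v v"
proof -
  have "col_submatrix A K $ i $ j * v $ j = A $ i $ j * v $ j" for i j
    using assms by (auto simp: col_submatrix_def vec_supp_def)
  then show ?thesis
    unfolding matrix_vector_mult_def by presburger
qed

lemma full_column_rank_on_kernel:
  fixes A :: "real ^ 'n ^ 'm"
  assumes rank: "full_column_rank_on A K" and v: "vec_supp v \<subseteq> K" "A *v v = 0"
  shows "v = 0"
proof (rule ccontr)
  assume "v \<noteq> 0"
  then obtain k where k: "v $ k \<noteq> 0"
    by (auto simp: vec_eq_iff)
  then have "k \<in> K"
    using v(1) by (auto simp: vec_supp_def)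
  let ?B = "col_submatrix A K" and ?C = "(\<lambda>i. column i A) ` (K - {k})"
  have "?B *v w \<in> span ?C" for w
  proof -
    \<comment> \<open>Subtracting a multiple of the kernel vector \<open>v\<close> removes column \<open>k\<close>.\<close>
    define z where "z = w - (w $ k / v $ k) *\<^sub>R v"
    have "?B *v v = 0"
      using v by (simp add: col_submatrix_mult_supp)
    then have "?B *v w = ?B *v z"
      by (simp add: z_def matrix_vector_mult_diff_distrib matrix_vector_mult_scaleR)
    also have "\<dots> = (\<Sum>i\<in>K. z $ i *\<^sub>R column i A)"
      by (rule col_submatrix_mult_vec)
    also have "\<dots> = (\<Sum>i\<in>K - {k}. z $ i *\<^sub>R column i A)"
      using k by (intro sum.mono_neutral_right) (auto simp: z_def)
    also have "\<dots> \<in> span ?C"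
      by (intro span_sum span_scale span_base) auto
    finally show ?thesis .
  qed
  then have "dim (range ((*v) ?B)) \<le> card ?C"
    by (intro dim_le_card) auto
  also have "\<dots> \<le> card (K - {k})"
    by (intro card_image_le) auto
  also have "\<dots> < card K"
    using \<open>k \<in> K\<close> by (intro card_Diff1_less) auto
  finally show False
    using rank by (simp add: full_column_rank_on_def rank_dim_range)
qed

text \<open>The minimum \<open>m\<close> of \<open>\<parallel>A v\<parallel>\<^sup>2\<close> over the unit vectors supported in \<open>K\<close> is attained at an
  eigenvector of \<open>A\<^sub>K\<^sup>T A\<^sub>K\<close>, so that \<open>sqrt m\<close> is the smallest positive singular value.\<close>

lemma sigma_min_bound:
  fixes A :: "real ^ 'n ^ 'm"
  assumes rank: "full_column_rank_on A K" and K: "K \<noteq> {}"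
  shows "sigma_min (col_submatrix A K) > 0"
    and "vec_supp v \<subseteq> K \<Longrightarrow>
      (sigma_min (col_submatrix A K))\<^sup>2 * (norm v)\<^sup>2 \<le> (norm (A *v v))\<^sup>2"
proof -
  let ?B = "col_submatrix A K" and ?V = "{v :: real ^ 'n. vec_supp v \<subseteq> K}"
  let ?U = "?V \<inter> sphere 0 1"
  let ?T = "transpose ?B ** ?B"
  note sub = subspace_supp[of K]
  have form: "u \<bullet> (?T *v w) = (A *v u) \<bullet> (A *v w)" if "u \<in> ?V" "w \<in> ?V" for u w
    using that col_submatrix_mult_supp[of _ K A]
    by (simp add: matrix_vector_mul_assoc[symmetric] dot_lmul_matrix del: transpose_matrix_vector)
      (metis dot_lmul_matrix transpose_matrix_vector vector_transpose_matrix inner_commute)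
  have T_supp: "?T *v w \<in> ?V" for w
    by (auto simp: vec_supp_def matrix_vector_mul_assoc[symmetric]
        transpose_col_submatrix_mult_vec simp del: transpose_matrix_vector split: if_splits)
  have "compact ?U"
    using closed_subspace[OF sub] by (simp add: closed_Int_compact)
  moreover obtain k where "k \<in> K"
    using K by blast
  then have "axis k 1 \<in> ?U"
    by (auto simp: vec_supp_def axis_eq_axis) (simp add: axis_def split: if_splits)
  moreover have "continuous_on ?U (\<lambda>v. (norm (A *v v))\<^sup>2)"
    by (intro continuous_intros matrix_vector_mult_linear_continuous_on)
  ultimately obtain u where u: "u \<in> ?U"
    and u_min: "\<And>v. v \<in> ?U \<Longrightarrow> (norm (A *v u))\<^sup>2 \<le> (norm (A *v v))\<^sup>2"
    using continuous_attains_inf[of ?U "\<lambda>v. (norm (A *v v))\<^sup>2"] by blast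
  define m where "m = (norm (A *v u))\<^sup>2"
  have "u \<noteq> 0" "norm u = 1"
    using u by auto
  then have m_pos: "0 < m"
    using full_column_rank_on_kernel[OF rank, of u] u by (auto simp: m_def)
  have m_le: "m * (norm v)\<^sup>2 \<le> (norm (A *v v))\<^sup>2" if v: "v \<in> ?V" for v
  proof (cases "v = 0")
    case False
    then have "(1 / norm v) *\<^sub>R v \<in> ?U"
      using subspace_scale[OF sub v] by simp
    from u_min[OF this] show ?thesis
      using False by (simp add: m_def matrix_vector_mult_scaleR power_divide field_simps)
  qed simp
  define w where "w = ?T *v u - m *\<^sub>R u"
  have w: "w \<in> ?V"
    unfolding w_def using T_supp[of u] u sub by (intro subspace_diff subspace_scale) auto
  define p where "p = (A *v u) \<bullet> (A *v w) - m * (u \<bullet> w)"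
  \<comment> \<open>The form \<open>\<parallel>A v\<parallel>\<^sup>2 - m \<parallel>v\<parallel>\<^sup>2\<close> is nonnegative and vanishes at \<open>u\<close>, so its derivative
    at \<open>u\<close> in the direction \<open>w\<close> vanishes too; this derivative is \<open>2 \<parallel>w\<parallel>\<^sup>2\<close>.\<close>
  have quad: "0 \<le> 2 * s * p + s\<^sup>2 * (norm (A *v w))\<^sup>2" for s
  proof -
    have "u + s *\<^sub>R w \<in> ?V"
      using u w sub by (intro subspace_add subspace_scale) auto
    from m_le[OF this] have "m * ((norm u)\<^sup>2 + 2 * s * (u \<bullet> w) + s\<^sup>2 * (norm w)\<^sup>2)
        \<le> (norm (A *v u))\<^sup>2 + 2 * s * ((A *v u) \<bullet> (A *v w)) + s\<^sup>2 * (norm (A *v w))\<^sup>2"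
      by (simp only: matrix_vector_right_distrib matrix_vector_mult_scaleR power2_norm_add_scaleR)
    moreover have "0 \<le> m * (s\<^sup>2 * (norm w)\<^sup>2)"
      using m_pos by simp
    ultimately have "m * (2 * s * (u \<bullet> w))
        \<le> 2 * s * ((A *v u) \<bullet> (A *v w)) + s\<^sup>2 * (norm (A *v w))\<^sup>2"
      unfolding \<open>norm u = 1\<close> m_def[symmetric]
      by (simp only: distrib_left power_one mult_1_right)
    then show ?thesis
      by (simp add: p_def algebra_simps)
  qed
  have "p = w \<bullet> (?T *v u) - m * (w \<bullet> u)"
    using form[OF w, of u] u by (simp add: p_def inner_commute)
  then have p: "p = (norm w)\<^sup>2"
    by (simp add: w_def power2_norm_eq_inner inner_diff_right)
  have "p = 0"
  proof (rule ccontr)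
    assume "p \<noteq> 0"
    then have "0 < p"
      using p by simp
    define q where "q = (norm (A *v w))\<^sup>2 + 1"
    have "0 < q"
      by (simp add: q_def add_nonneg_pos)
    \<comment> \<open>\<open>s = - p / q\<close> minimizes \<open>2 s p + s\<^sup>2 q\<close>; the minimum \<open>- p\<^sup>2 / q\<close> is negative.\<close>
    have "0 \<le> 2 * (- p / q) * p + (- p / q)\<^sup>2 * (norm (A *v w))\<^sup>2"
      by (rule quad)
    also have "\<dots> \<le> 2 * (- p / q) * p + (- p / q)\<^sup>2 * q"
      by (intro add_left_mono mult_left_mono) (auto simp: q_def)
    also have "\<dots> = - (p\<^sup>2 / q)"
      using \<open>0 < q\<close> by (simp add: field_simps power2_eq_square)
    also have "\<dots> < 0"
      using \<open>0 < q\<close> \<open>0 < p\<close> by simp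
    finally show False
      by simp
  qed
  then have "?T *v u = m *\<^sub>R u"
    using p by (simp add: w_def)
  then have sing: "singular_value ?B (sqrt m)"
    using m_pos \<open>u \<noteq> 0\<close> by (auto simp: singular_value_def)
  have "sqrt m \<le> s" if s: "0 < s" "singular_value ?B s" for s
  proof -
    obtain v where v: "v \<noteq> 0" "?T *v v = s\<^sup>2 *\<^sub>R v"
      using s(2) by (auto simp: singular_value_def)
    have "v = (1 / s\<^sup>2) *\<^sub>R (?T *v v)"
      using s(1) v(2) by simp
    then have vV: "v \<in> ?V"
      using subspace_scale[OF sub T_supp] by metis
    have "m * (norm v)\<^sup>2 \<le> s\<^sup>2 * (norm v)\<^sup>2"
      using m_le[OF vV] form[OF vV vV] v(2) by (simp add: power2_norm_eq_inner)
    then have "m \<le> s\<^sup>2"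
      using v(1) by simp
    then show ?thesis
      using s(1) by (simp add: real_le_lsqrt)
  qed
  then have sig: "sigma_min ?B = sqrt m"
    unfolding sigma_min_def using sing m_pos by (intro Least_equality) auto
  show "sigma_min ?B > 0"
    using sig m_pos by simp
  show "vec_supp v \<subseteq> K \<Longrightarrow> (sigma_min ?B)\<^sup>2 * (norm v)\<^sup>2 \<le> (norm (A *v v))\<^sup>2"
    using sig m_pos m_le[of v] by simp
qed

section \<open>Lipschitz continuity of the solution map\<close>

lemma locally_lipschitz_withI:
  fixes f :: "real \<Rightarrow> 'a :: real_normed_vector"
  assumes U: "open U" "l \<in> U" and S: "\<And>t. t \<in> U \<Longrightarrow> S t = {f t}" and lip: "C-lipschitz_on U f"
  shows "\<exists>L. locally_lipschitz_with S l L \<and> L \<le> C"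
proof -
  let ?F = "at (l, l) within {(t, t'). t \<noteq> t'}"
  let ?q = "\<lambda>(t, t'). ereal (norm (f t - f t') / \<bar>t - t'\<bar>)"
  have nontrivial: "?F \<noteq> bot"
    unfolding trivial_limit_within islimpt_approachable
  proof (clarsimp simp only: not_not)
    fix e :: real
    assume "0 < e"
    then show "\<exists>x'\<in>{(t, t'). t \<noteq> t'}. x' \<noteq> (l, l) \<and> dist x' (l, l) < e"
      by (intro bexI[of _ "(l + e / 2, l)"]) (auto simp: dist_prod_def dist_real_def)
  qed
  have "open (U \<times> U)" "(l, l) \<in> U \<times> U"
    using U by (auto intro: open_Times)
  then have "\<forall>\<^sub>F z in ?F. z \<in> U \<times> U"
    unfolding eventually_at_topological by blast
  moreover have "\<forall>\<^sub>F z in ?F. z \<in> {(t, t'). t \<noteq> t'}"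
    by (simp add: eventually_at_filter)
  ultimately have "\<forall>\<^sub>F z in ?F. ?q z \<le> ereal C"
  proof eventually_elim
    case (elim z)
    then show ?case
      using lipschitz_onD[OF lip, of "fst z" "snd z"]
      by (auto simp: dist_norm divide_le_eq split: prod.splits)
  qed
  then have upper: "lipschitz_modulus f l \<le> ereal C"
    unfolding lipschitz_modulus_def by (rule Limsup_bounded)
  have lower: "ereal 0 \<le> lipschitz_modulus f l"
    unfolding lipschitz_modulus_def
    by (intro le_Limsup[OF nontrivial] always_eventually) auto
  obtain L where L: "lipschitz_modulus f l = ereal L"
    using upper lower by (cases "lipschitz_modulus f l") auto
  then have "locally_lipschitz_with S l L"
    unfolding locally_lipschitz_with_def using U S lip by metis
  then show ?thesis
    using upper L by auto
qed

text \<open>If \<open>K\<close> is empty, \<open>sigma_min\<close> is unspecified, but then \<open>x\<close> and \<open>x'\<close> both vanish.\<close>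

lemma lasso_lipschitz:
  fixes A :: "real ^ 'n ^ 'm"
  assumes rank: "full_column_rank_on A K"
    and x: "x \<in> lasso_argmin A b t" "vec_supp x \<subseteq> K" "0 \<le> t"
    and x': "x' \<in> lasso_argmin A b t'" "vec_supp x' \<subseteq> K" "0 \<le> t'"
  shows "norm (x - x')
    \<le> sqrt (real (card K)) * sigma_min (col_submatrix A K) powi (-2) * \<bar>t - t'\<bar>"
proof -
  define d where "d = norm (x - x')"
  define s where "s = sigma_min (col_submatrix A K)"
  have supp: "vec_supp (x - x') \<subseteq> K"
  proof
    fix i
    assume "i \<in> vec_supp (x - x')"
    then have "i \<in> vec_supp x \<or> i \<in> vec_supp x'"
      by (auto simp: vec_supp_def)
    then show "i \<in> K"
      using x(2) x'(2) by blast
  qed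
  show ?thesis
  proof (cases "x = x'")
    case False
    then have "K \<noteq> {}"
      using supp by (auto simp: vec_supp_def vec_eq_iff)
    note sig = sigma_min_bound[OF rank this]
    have "s\<^sup>2 * d\<^sup>2 \<le> (norm (A *v (x - x')))\<^sup>2"
      using sig(2)[OF supp] by (simp add: s_def d_def)
    also have "\<dots> \<le> \<bar>t - t'\<bar> * \<bar>l1_norm x - l1_norm x'\<bar>"
      using lasso_two_minimizers_abs x x' by blast
    also have "\<dots> \<le> \<bar>t - t'\<bar> * (sqrt (real (card K)) * d)"
      using l1_norm_diff_le[of x x'] l1_norm_le_sqrt_card_norm[OF supp]
      by (intro mult_left_mono) (auto simp: d_def)
    finally have "s\<^sup>2 * d \<le> \<bar>t - t'\<bar> * sqrt (real (card K))"
      using False by (simp add: d_def power2_eq_square)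
    then show ?thesis
      using sig(1) by (simp add: power_int_minus field_simps flip: s_def d_def)
  qed (simp add: power_int_minus)
qed

lemma lasso_locally_lipschitz:
  fixes A :: "real ^ 'n ^ 'm"
  assumes lam: "0 < lam" and xbar: "xbar \<in> lasso_argmin A b lam"
    and J: "J = {i. \<bar>column i A \<bullet> (b - A *v xbar)\<bar> = lam}"
    and rank: "full_column_rank_on A J"
  shows "\<exists>L. locally_lipschitz_with (lasso_argmin A b) lam L \<and>
    L \<le> sqrt (real (card J)) * sigma_min (col_submatrix A J) powi (-2)"
proof -
  have "\<forall>\<^sub>F t in nhds lam. 0 < t \<and> (\<forall>x\<in>lasso_argmin A b t. vec_supp x \<subseteq> J)"
    using eventually_lasso_supp_subset[OF lam xbar J] lam
    by (intro eventually_conj order_tendstoD(1)[OF filterlim_ident])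
  then obtain U where U: "open U" "lam \<in> U"
    and supp: "\<And>t x. t \<in> U \<Longrightarrow> x \<in> lasso_argmin A b t \<Longrightarrow> vec_supp x \<subseteq> J"
    and pos: "\<And>t. t \<in> U \<Longrightarrow> 0 < t"
    unfolding eventually_nhds by blast
  let ?C = "sqrt (real (card J)) * sigma_min (col_submatrix A J) powi (-2)"
  define f where "f t = (SOME x. x \<in> lasso_argmin A b t)" for t
  have lip: "norm (x - x') \<le> ?C * \<bar>t - t'\<bar>"
    if "t \<in> U" "t' \<in> U" "x \<in> lasso_argmin A b t" "x' \<in> lasso_argmin A b t'" for t t' x x'
    using that supp pos by (intro lasso_lipschitz[OF rank]) (auto intro: less_imp_le)
  have f: "f t \<in> lasso_argmin A b t" if "t \<in> U" for t
    unfolding f_def using lasso_argmin_nonempty[OF pos[OF that]] by (simp add: some_in_eq)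
  have "lasso_argmin A b t = {f t}" if "t \<in> U" for t
  proof -
    have "x = f t" if "x \<in> lasso_argmin A b t" for x
      using lip[OF \<open>t \<in> U\<close> \<open>t \<in> U\<close> that f[OF \<open>t \<in> U\<close>]] by simp
    then show ?thesis
      using f[OF that] by blast
  qed
  moreover have "?C-lipschitz_on U f"
    using lip f by (intro lipschitz_onI) (auto simp: dist_norm power_int_minus)
  ultimately show ?thesis
    using locally_lipschitz_withI[OF U] by blast
qed

theorem corollary4p17:
  fixes A :: "real ^ 'n ^ 'm" and b :: "real ^ 'm" and lam :: real and xbar :: "real ^ 'n"
    and I J :: "'n set" and S :: "real \<Rightarrow> (real ^ 'n) set"
  assumes "lam > 0"
    and "xbar \<in> lasso_argmin A b lam"
    and "I = vec_supp xbar"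
    and "J = {i. \<bar>column i A \<bullet> (b - A *v xbar)\<bar> = lam}"
    and "S = (\<lambda>t. lasso_argmin A b t)"
  shows "(full_column_rank_on A J \<longrightarrow>
           (\<exists>L. locally_lipschitz_with S lam L \<and>
                L \<le> sqrt (real (card J)) * sigma_min (col_submatrix A J) powi (-2))) \<and>
         (full_column_rank_on A I \<and>
            infnorm (transpose (col_submatrix A (- I)) *v (b - col_submatrix A I *v xbar)) < lam \<longrightarrow>
           (\<exists>L. locally_lipschitz_with S lam L \<and>
                L \<le> sqrt (real (card I)) * sigma_min (col_submatrix A I) powi (-2)))"
proof -
  have I_J: "I = J" if "infnorm (transpose (col_submatrix A (- I)) *v (b - col_submatrix A I *v xbar)) < lam"
  proof
    show "I \<subseteq> J"
      using lasso_gradient_on_supp[OF assms(2)] assms(1,3,4) by (auto simp: vec_supp_def)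
    have "\<bar>column i A \<bullet> (b - A *v xbar)\<bar> < lam" if "i \<notin> I" for i
    proof -
      have "(transpose (col_submatrix A (- I)) *v (b - A *v xbar)) $ i
          = column i A \<bullet> (b - A *v xbar)"
        using that by (simp add: transpose_col_submatrix_mult_vec del: transpose_matrix_vector)
      moreover have "col_submatrix A I *v xbar = A *v xbar"
        using assms(3) by (simp add: col_submatrix_mult_supp)
      ultimately show ?thesis
        using \<open>infnorm _ < lam\<close>
          component_le_infnorm_cart[of "transpose (col_submatrix A (- I)) *v (b - A *v xbar)" i]
        by simp
    qed
    then show "J \<subseteq> I"
      using assms(4) by force
  qed
  show ?thesis
    using lasso_locally_lipschitz[OF assms(1,2,4)] I_J assms(5) by auto
qed

end
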